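(* For every integer $n \ge 5$ with $n \equiv 3,5 \pmod{7}$, there is a unique binary LCD $[n,3,\lfloor 4n/7 \rfloor]$ code, up to equivalence.
   Context: All codes are binary linear codes; an $[n,k,d]$ code is a $k$-dimensional subspace of $\mathbb{F}_2^n$ with minimum nonzero Hamming weight $d$. A code $C$ is LCD if $C \cap C^\perp = \{\mathbf{0}_n\}$, where $C^\perp$ is the dual with respect to the standard inner product. Two binary codes are equivalent if one is obtained from the other by a permutation of coordinates. *)

theory Defs
  imports
    "Jordan_Normal_Form.VS_Connect"
    "HOL-Library.Z2"
    "HOL-Combinatorics.Permutations"
begin

text \<open>Codewords of length \<open>n\<close> are the elements of \<^term>\<open>carrier_vec n :: bit vec set\<close>, where
  \<^typ>\<open>bit\<close> is the field with two elements.\<close>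

definition hamming_weight :: "bit vec \<Rightarrow> nat" where
  "hamming_weight v = card {i. i < dim_vec v \<and> v $ i \<noteq> 0}"

definition linear_code :: "nat \<Rightarrow> bit vec set \<Rightarrow> bool" where
  "linear_code n C \<longleftrightarrow> VectorSpace.subspace class_ring C (module_vec TYPE(bit) n)"

definition code_dim :: "nat \<Rightarrow> bit vec set \<Rightarrow> nat" where
  "code_dim n C = vectorspace.dim class_ring (module_vec TYPE(bit) n\<lparr>carrier := C\<rparr>)"

text \<open>Meaningful only for codes containing a nonzero word; over \<^typ>\<open>bit\<close> every code of length
  \<open>n\<close> is finite, so this minimum then exists.\<close>

definition min_weight :: "nat \<Rightarrow> bit vec set \<Rightarrow> nat" where
  "min_weight n C = Min (hamming_weight ` (C - {0\<^sub>v n}))"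

definition is_code :: "nat \<Rightarrow> nat \<Rightarrow> nat \<Rightarrow> bit vec set \<Rightarrow> bool" where
  "is_code n k d C \<longleftrightarrow> linear_code n C \<and> code_dim n C = k \<and> min_weight n C = d"

definition dual_code :: "nat \<Rightarrow> bit vec set \<Rightarrow> bit vec set" where
  "dual_code n C = {x \<in> carrier_vec n. \<forall>c\<in>C. x \<bullet> c = 0}"

definition lcd_code :: "nat \<Rightarrow> bit vec set \<Rightarrow> bool" where
  "lcd_code n C \<longleftrightarrow> C \<inter> dual_code n C = {0\<^sub>v n}"

definition permute_coords :: "nat \<Rightarrow> (nat \<Rightarrow> nat) \<Rightarrow> bit vec \<Rightarrow> bit vec" where
  "permute_coords n \<pi> v = vec n (\<lambda>i. v $ \<pi> i)"

definition code_equiv :: "nat \<Rightarrow> bit vec set \<Rightarrow> bit vec set \<Rightarrow> bool" where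
  "code_equiv n C D \<longleftrightarrow> (\<exists>\<pi>. \<pi> permutes {..<n} \<and> D = permute_coords n \<pi> ` C)"

end

theory Submission
  imports Defs
begin

text \<open>
  Write \<open>n = 7 s + 3 + 2 t\<close> with \<open>t \<in> {0, 1}\<close>, so that \<open>d = 4 s + 1 + t\<close>. The weights of the seven
  nonzero words add up to \<open>4 (n - m)\<close>, where \<open>m\<close> counts the zero columns of a generator matrix.
  An LCD code of dimension 3 has a word of odd weight, hence four of them, and three nonzero words
  of even weight. The former weigh at least \<open>4 s + 1 + 2 t\<close>, the latter at least \<open>4 s + 2\<close>, which
  leaves a slack of \<open>2 - 4 m\<close>: so \<open>m = 0\<close> and, by parity, one word exceeds its bound by 2.
  If that word had even weight, it would be orthogonal to the whole code; so it is an odd word, and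
  it is the sum of the other three odd words, which form a basis. All weights in terms of this
  basis are now known. They determine the multiplicity of every column, hence the code up to a
  permutation of coordinates.
\<close>

\<comment> \<open>These simp rules turn the field operations into bitwise ones, also inside \<open>class_ring\<close>,
  where they break the matching with the vector space library.\<close>
declare add_bit_eq_xor [simp del] mult_bit_eq_and [simp del]

section \<open>Ordered bases of three-dimensional binary codes\<close>

lemma bit_add_self: "(a::bit) + a = 0"
  by (cases a) simp_all

text \<open>Over two elements, linear independence means that none of the seven nontrivial sums
  vanishes. Listing all eight words turns a change of basis into a rearrangement of a finite set and
  lets weights be tabulated word by word.\<close>

definition basis3 :: "nat \<Rightarrow> bit vec set \<Rightarrow> bit vec \<Rightarrow> bit vec \<Rightarrow> bit vec \<Rightarrow> bool" where
  "basis3 n D x y z \<longleftrightarrow> x \<in> carrier_vec n \<and> y \<in> carrier_vec n \<and> z \<in> carrier_vec n \<and>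
     D = {0\<^sub>v n, x, y, z, x + y, x + z, y + z, x + y + z} \<and>
     0\<^sub>v n \<notin> {x, y, z, x + y, x + z, y + z, x + y + z}"

lemma bit_vec_add_self:
  fixes x :: "bit vec"
  assumes "x \<in> carrier_vec n"
  shows "x + x = 0\<^sub>v n"
  by (rule eq_vecI) (use assms in \<open>auto simp: bit_add_self\<close>)

lemma bit_vec_add_cancel:
  fixes x y :: "bit vec"
  assumes "x \<in> carrier_vec n" "y \<in> carrier_vec n"
  shows "x + y + y = x"
  using assoc_add_vec[OF assms(1,2,2)] assms by (simp add: bit_vec_add_self[of _ n])

lemma bit_vec_add_left_cancel:
  fixes x y :: "bit vec"
  assumes "x \<in> carrier_vec n" "y \<in> carrier_vec n"
  shows "x + (x + y) = y"
  using assoc_add_vec[OF assms(1,1,2)] assms by (simp add: bit_vec_add_self[of _ n])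

lemma basis3_swap12:
  assumes "basis3 n D x y z"
  shows "basis3 n D y x z"
proof -
  have "y + x = x + y"
    using assms by (auto simp: basis3_def intro: comm_add_vec)
  with assms show ?thesis
    unfolding basis3_def by (elim conjE) (simp add: insert_commute)
qed

lemma basis3_swap23:
  assumes "basis3 n D x y z"
  shows "basis3 n D x z y"
proof -
  have c: "x \<in> carrier_vec n" "y \<in> carrier_vec n" "z \<in> carrier_vec n"
    using assms by (auto simp: basis3_def)
  have e: "z + y = y + z"
    using c by (auto intro: comm_add_vec)
  moreover have "x + z + y = x + y + z"
    using c e by (simp add: assoc_add_vec[of x n])
  ultimately show ?thesis
    using assms unfolding basis3_def by (elim conjE) (simp add: insert_commute)
qed

text \<open>This elementary row operation only rearranges the eight words, since
  \<open>x + y + y = x\<close>. Together with the two swaps it generates all changes of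
  basis.\<close>

lemma basis3_add12:
  assumes "basis3 n D x y z"
  shows "basis3 n D (x + y) y z"
proof -
  have "x + y + y = x"
    using assms by (auto simp: basis3_def intro: bit_vec_add_cancel)
  with assms show ?thesis
    unfolding basis3_def by (elim conjE) (simp add: insert_commute)
qed

text \<open>Row operations can move any of the seven nonzero words into the first position.\<close>

lemma basis3_extend:
  assumes "basis3 n D x y z" "u \<in> D" "u \<noteq> 0\<^sub>v n"
  shows "\<exists>v w. basis3 n D u v w"
proof -
  note b = assms(1)
  have "u \<in> {x, y, z, x + y, x + z, y + z, x + y + z}"
    using assms unfolding basis3_def by auto
  \<comment> \<open>The seven facts below put \<open>x\<close>, \<open>y\<close>, \<open>z\<close>,
    \<open>x + y\<close>, \<open>x + z\<close>, \<open>y + z\<close>, \<open>x + y + z\<close>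
    first, in this order.\<close>
  then show ?thesis
    using b basis3_swap12[OF b] basis3_swap12[OF basis3_swap23[OF b]]
      basis3_add12[OF b] basis3_add12[OF basis3_swap23[OF b]]
      basis3_add12[OF basis3_swap23[OF basis3_swap12[OF b]]]
      basis3_add12[OF basis3_swap23[OF basis3_add12[OF b]]]
    by auto
qed

section \<open>Linear codes and dimension in terms of explicit bases\<close>

text \<open>The only scalars are 0 and 1, so closure under scalar multiplication comes from the
  presence of the zero word.\<close>

lemma linear_code_iff:
  "linear_code n C \<longleftrightarrow> C \<subseteq> carrier_vec n \<and> 0\<^sub>v n \<in> C \<and> (\<forall>x\<in>C. \<forall>y\<in>C. x + y \<in> C)"
proof -
  interpret vec_space "TYPE(bit)" n .
  have "linear_code n C \<longleftrightarrow> submodule class_ring C (module_vec TYPE(bit) n)"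
    unfolding linear_code_def VectorSpace.subspace_def using vec_vs[of n, where 'a = bit] by auto
  also have "\<dots> \<longleftrightarrow> C \<subseteq> carrier_vec n \<and> 0\<^sub>v n \<in> C \<and> (\<forall>x\<in>C. \<forall>y\<in>C. x + y \<in> C)"
  proof -
    have "c \<cdot>\<^sub>v x \<in> C" if "x \<in> C" "C \<subseteq> carrier_vec n" "0\<^sub>v n \<in> C" for c and x
    proof (cases "c = 0")
      case True
      then have "c \<cdot>\<^sub>v x = 0\<^sub>v n" using that by (intro eq_vecI) auto
      then show ?thesis using that by simp
    next
      case False
      then show ?thesis using that by auto
    qed
    then show ?thesis
      unfolding submodule_def using vec_module by (auto simp: module_vec_simps)
  qed
  finally show ?thesis .
qed

lemma basis3_imp_linear_code:
  assumes "basis3 n D x y z"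
  shows "linear_code n D"
proof -
  have carrier: "D \<subseteq> carrier_vec n" and zero: "0\<^sub>v n \<in> D"
    using assms by (auto simp: basis3_def)
  have "u + v \<in> D" if "u \<in> D" "v \<in> D" for u v
  proof (cases "u = 0\<^sub>v n")
    case True
    then show ?thesis using that carrier by auto
  next
    case False
    \<comment> \<open>With \<open>u\<close> as first basis word, only eight sums
      \<open>u + v\<close> have to be checked instead of sixty-four.\<close>
    then obtain y' z' where "basis3 n D u y' z'"
      using basis3_extend[OF assms \<open>u \<in> D\<close>] by auto
    then have c: "u \<in> carrier_vec n" "y' \<in> carrier_vec n" "z' \<in> carrier_vec n"
      and D: "D = {0\<^sub>v n, u, y', z', u + y', u + z', y' + z', u + y' + z'}"
      by (auto simp: basis3_def)
    have "u + 0\<^sub>v n = u" "u + u = 0\<^sub>v n" "u + (u + y') = y'" "u + (u + z') = z'"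
      "u + (y' + z') = u + y' + z'" "u + (u + y' + z') = y' + z'"
      using c by (simp_all add: bit_vec_add_self[of _ n] bit_vec_add_left_cancel[of _ n]
          assoc_add_vec[of u n y' z'])
    moreover have "v \<in> {0\<^sub>v n, u, y', z', u + y', u + z', y' + z', u + y' + z'}"
      using that(2) D by simp
    ultimately show ?thesis
      unfolding D by (elim insertE emptyE) simp_all
  qed
  then show ?thesis
    unfolding linear_code_iff using carrier zero by auto
qed

text \<open>\<open>code_dim\<close> treats the code as a vector space in its own right. For subsets
  of a subspace, span and independence are the same there as in the ambient space.\<close>

lemma code_dim_eq_card:
  assumes "linear_code n C" "B \<subseteq> C" "finite B"
    and "\<not> module.lin_dep class_ring (module_vec TYPE(bit) n) B"
    and "LinearCombinations.module.span class_ring (module_vec TYPE(bit) n) B = C"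
  shows "code_dim n C = card B"
proof -
  interpret vec_space "TYPE(bit)" n .
  have s: "VectorSpace.subspace class_ring C (module_vec TYPE(bit) n)"
    using assms(1) by (simp add: linear_code_def)
  interpret W: vectorspace class_ring "module_vec TYPE(bit) n\<lparr>carrier := C\<rparr>"
    by (rule subspace_is_vs[OF s])
  have "W.basis B"
    unfolding W.basis_def
    using assms span_li_not_depend[OF assms(2) is_module[OF s]] by auto
  then show ?thesis
    unfolding code_dim_def using W.dim_basis[OF assms(3)] by simp
qed

lemma code_basis_exists:
  assumes "linear_code n C" "finite C"
  obtains B where "B \<subseteq> C" "card B = code_dim n C" "finite B"
    and "\<not> module.lin_dep class_ring (module_vec TYPE(bit) n) B"
    and "LinearCombinations.module.span class_ring (module_vec TYPE(bit) n) B = C"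
proof -
  interpret vec_space "TYPE(bit)" n .
  have s: "VectorSpace.subspace class_ring C (module_vec TYPE(bit) n)"
    using assms(1) by (simp add: linear_code_def)
  interpret W: vectorspace class_ring "module_vec TYPE(bit) n\<lparr>carrier := C\<rparr>"
    by (rule subspace_is_vs[OF s])
  have "W.span C = C"
    using W.in_own_span[of C] W.span_is_subset2[of C] by auto
  then have "W.fin_dim"
    unfolding W.fin_dim_def using assms(2) by (auto intro!: exI[of _ C])
  then obtain B where B: "finite B" "W.basis B"
    using W.finite_basis_exists by auto
  then have "B \<subseteq> C" by (auto simp: W.basis_def)
  then show ?thesis
    using that[of B] B W.dim_basis[OF B] span_li_not_depend[OF \<open>B \<subseteq> C\<close> is_module[OF s]]
    unfolding code_dim_def W.basis_def by auto
qed

lemma basis3_imp_code_dim: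
  assumes "basis3 n D x y z"
  shows "code_dim n D = 3"
proof -
  interpret vec_space "TYPE(bit)" n .
  have c: "x \<in> carrier_vec n" "y \<in> carrier_vec n" "z \<in> carrier_vec n"
    and D: "D = {0\<^sub>v n, x, y, z, x + y, x + z, y + z, x + y + z}"
    and nz: "x \<noteq> 0\<^sub>v n" "y \<noteq> 0\<^sub>v n" "z \<noteq> 0\<^sub>v n" "x + y \<noteq> 0\<^sub>v n" "x + z \<noteq> 0\<^sub>v n" "y + z \<noteq> 0\<^sub>v n"
      "x + y + z \<noteq> 0\<^sub>v n"
    using assms by (auto simp: basis3_def)
  have dist: "x \<noteq> y" "x \<noteq> z" "y \<noteq> z"
    using nz c by (auto simp: bit_vec_add_self[of _ n])
  have lc: "lincomb a {x,y,z} = a x \<cdot>\<^sub>v x + a y \<cdot>\<^sub>v y + a z \<cdot>\<^sub>v z" for a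
  proof (rule eq_vecI)
    show "dim_vec (lincomb a {x,y,z}) = dim_vec (a x \<cdot>\<^sub>v x + a y \<cdot>\<^sub>v y + a z \<cdot>\<^sub>v z)"
      using c lincomb_dim[of "{x,y,z}"] by auto
    fix i assume "i < dim_vec (a x \<cdot>\<^sub>v x + a y \<cdot>\<^sub>v y + a z \<cdot>\<^sub>v z)"
    then have "i < n" using c by auto
    then show "lincomb a {x,y,z} $ i = (a x \<cdot>\<^sub>v x + a y \<cdot>\<^sub>v y + a z \<cdot>\<^sub>v z) $ i"
      using c dist by (subst lincomb_index) (auto simp del: add_bit_eq_xor mult_bit_eq_and simp: add.assoc)
  qed
  have z0: "(0::bit) \<cdot>\<^sub>v v = 0\<^sub>v n" if "v \<in> carrier_vec n" for v
    using that by (intro eq_vecI) auto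
  \<comment> \<open>Every nonzero choice of coefficients yields one of the seven words, and none of
    them is zero.\<close>
  have "lin_indpt {x,y,z}"
  proof (rule finite_lin_indpt2)
    fix a assume "lincomb a {x,y,z} = 0\<^sub>v n"
    then show "\<forall>v\<in>{x,y,z}. a v = 0"
      unfolding lc using nz c
      by (cases "a x"; cases "a y"; cases "a z") (auto simp: z0)
  qed (use c in auto)
  moreover have "span {x,y,z} = D"
  proof
    show "span {x,y,z} \<subseteq> D"
      using basis3_imp_linear_code[OF assms]
      by (intro span_is_subset) (auto simp: D linear_code_def VectorSpace.subspace_def)
    have add: "u + v \<in> span {x,y,z}" if "u \<in> span {x,y,z}" "v \<in> span {x,y,z}" for u v
      using span_add1[OF _ that] c by auto
    have "x \<in> span {x,y,z}" "y \<in> span {x,y,z}" "z \<in> span {x,y,z}"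
      using in_own_span[of "{x,y,z}"] c by auto
    then show "D \<subseteq> span {x,y,z}"
      unfolding D using add span_zero by auto
  qed
  ultimately have "code_dim n D = card {x,y,z}"
    using basis3_imp_linear_code[OF assms] by (intro code_dim_eq_card) (auto simp: D)
  then show ?thesis using dist by simp
qed

lemma finite_carrier_vec_bit: "finite (carrier_vec n :: bit vec set)"
proof -
  have "finite {xs :: bit list. set xs \<subseteq> {0, 1} \<and> length xs = n}"
    by (rule finite_lists_length_eq) simp
  moreover have "carrier_vec n \<subseteq> vec_of_list ` {xs :: bit list. set xs \<subseteq> {0, 1} \<and> length xs = n}"
  proof
    fix v :: "bit vec" assume "v \<in> carrier_vec n"
    then show "v \<in> vec_of_list ` {xs :: bit list. set xs \<subseteq> {0, 1} \<and> length xs = n}"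
      by (intro image_eqI[of _ _ "list_of_vec v"]) (auto simp: vec_list)
  qed
  ultimately show ?thesis
    by (meson finite_surj)
qed

lemma basis3_exists:
  assumes "linear_code n D" "code_dim n D = 3"
  obtains x y z where "basis3 n D x y z"
proof -
  interpret vec_space "TYPE(bit)" n .
  have sub: "D \<subseteq> carrier_vec n" using assms(1) by (simp add: linear_code_iff)
  obtain B where B: "B \<subseteq> D" "card B = 3" "finite B" "lin_indpt B" "span B = D"
    using code_basis_exists[OF assms(1) finite_subset[OF sub finite_carrier_vec_bit]] assms(2) by metis
  then obtain x y z where xyz: "B = {x,y,z}" and dist: "x \<noteq> y" "x \<noteq> z" "y \<noteq> z"
    by (auto simp: card_3_iff)
  have c: "x \<in> carrier_vec n" "y \<in> carrier_vec n" "z \<in> carrier_vec n"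
    using B sub xyz by auto
  \<comment> \<open>Over two elements a nontrivial combination of \<open>B\<close> is the plain sum
    of a nonempty subset, so the constant coefficient 1 captures all of them; \<open>li\<close> then
    identifies these sums with the seven words.\<close>
  have ne: "lincomb (\<lambda>_. 1) S \<noteq> 0\<^sub>v n" if "S \<subseteq> B" "v \<in> S" for S v
    using lin_dep_crit[OF finite_subset[OF that(1) B(3)] that(1) _ that(2), of "\<lambda>_. 1"] B(4) by auto
  have li: "lincomb (\<lambda>_. 1) S = w" if "S \<subseteq> B" "w \<in> carrier_vec n" "\<And>i. i < n \<Longrightarrow> (\<Sum>v\<in>S. v $ i) = w $ i" for S w
    using that B sub lincomb_dim[OF finite_subset[OF that(1) B(3)], of "\<lambda>_. 1"]
    by (intro eq_vecI) (auto simp: lincomb_index)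
  have nz: "x \<noteq> 0\<^sub>v n" "y \<noteq> 0\<^sub>v n" "z \<noteq> 0\<^sub>v n" "x + y \<noteq> 0\<^sub>v n" "x + z \<noteq> 0\<^sub>v n" "y + z \<noteq> 0\<^sub>v n"
      "x + y + z \<noteq> 0\<^sub>v n"
  proof -
    show "x \<noteq> 0\<^sub>v n" using ne[of "{x}" x] li[of "{x}" x] c xyz by simp
    show "y \<noteq> 0\<^sub>v n" using ne[of "{y}" y] li[of "{y}" y] c xyz by simp
    show "z \<noteq> 0\<^sub>v n" using ne[of "{z}" z] li[of "{z}" z] c xyz by simp
    show "x + y \<noteq> 0\<^sub>v n" using ne[of "{x,y}" x] li[of "{x,y}" "x + y"] c xyz dist by simp
    show "x + z \<noteq> 0\<^sub>v n" using ne[of "{x,z}" x] li[of "{x,z}" "x + z"] c xyz dist by simp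
    show "y + z \<noteq> 0\<^sub>v n" using ne[of "{y,z}" y] li[of "{y,z}" "y + z"] c xyz dist by simp
    show "x + y + z \<noteq> 0\<^sub>v n"
      using ne[of "{x,y,z}" x] li[of "{x,y,z}" "x + y + z"] c xyz dist by (simp add: add.assoc)
  qed
  have b: "basis3 n {0\<^sub>v n, x, y, z, x + y, x + z, y + z, x + y + z} x y z" (is "basis3 n ?E x y z")
    using c nz by (auto simp: basis3_def)
  have "span {x,y,z} \<subseteq> ?E"
    using basis3_imp_linear_code[OF b]
    by (intro span_is_subset) (auto simp: linear_code_def VectorSpace.subspace_def)
  moreover have "?E \<subseteq> D"
    using assms(1) B(1) xyz by (auto simp: linear_code_iff)
  ultimately have "D = ?E" using B(5) xyz by auto
  then show ?thesis using b that by simp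
qed

section \<open>Column multiplicities of a generator matrix and weights\<close>

lemma card_eq_sum_fibres:
  fixes f :: "nat \<Rightarrow> 'a"
  assumes "finite P"
  shows "card {i. i < n \<and> f i \<in> P} = (\<Sum>p\<in>P. card {i. i < n \<and> f i = p})"
  using assms
proof (induction P rule: finite_induct)
  case (insert p P)
  have "{i. i < n \<and> f i \<in> insert p P} = {i. i < n \<and> f i = p} \<union> {i. i < n \<and> f i \<in> P}"
    by auto
  moreover have "card ({i. i < n \<and> f i = p} \<union> {i. i < n \<and> f i \<in> P}) =
      card {i. i < n \<and> f i = p} + card {i. i < n \<and> f i \<in> P}"
    using insert.hyps by (intro card_Un_disjoint) auto
  ultimately show ?case
    by (simp only: insert.IH sum.insert[OF insert.hyps])
qed simp

text \<open>The multiplicity of a column in the generator matrix with rows \<open>x\<close>,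
  \<open>y\<close>, \<open>z\<close>. It forgets the positions of columns, which is exactly what a
  permutation of coordinates may change.\<close>

definition column_count :: "nat \<Rightarrow> bit vec \<Rightarrow> bit vec \<Rightarrow> bit vec \<Rightarrow> bit \<times> bit \<times> bit \<Rightarrow> nat" where
  "column_count n x y z p = card {i. i < n \<and> (x $ i, y $ i, z $ i) = p}"

lemma card_columns:
  assumes "finite P" "\<And>i. i < n \<Longrightarrow> Q i \<longleftrightarrow> (x $ i, y $ i, z $ i) \<in> P"
  shows "card {i. i < n \<and> Q i} = sum (column_count n x y z) P"
proof -
  have "{i. i < n \<and> Q i} = {i. i < n \<and> (x $ i, y $ i, z $ i) \<in> P}"
    using assms(2) by auto
  then show ?thesis
    using card_eq_sum_fibres[OF assms(1), of n "\<lambda>i. (x $ i, y $ i, z $ i)"]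
    by (simp add: column_count_def)
qed

text \<open>A nonzero word arises by applying a nonzero linear functional to each column, and such a
  functional is nonzero on exactly four of the eight possible columns.\<close>

lemma hamming_weight_columns:
  assumes c: "x \<in> carrier_vec n" "y \<in> carrier_vec n" "z \<in> carrier_vec n"
  defines "N \<equiv> column_count n x y z"
  shows "hamming_weight x = N (1,0,0) + N (1,1,0) + N (1,0,1) + N (1,1,1)"
    and "hamming_weight y = N (0,1,0) + N (1,1,0) + N (0,1,1) + N (1,1,1)"
    and "hamming_weight z = N (0,0,1) + N (1,0,1) + N (0,1,1) + N (1,1,1)"
    and "hamming_weight (x + y) = N (1,0,0) + N (0,1,0) + N (1,0,1) + N (0,1,1)"
    and "hamming_weight (x + z) = N (1,0,0) + N (0,0,1) + N (1,1,0) + N (0,1,1)"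
    and "hamming_weight (y + z) = N (0,1,0) + N (0,0,1) + N (1,1,0) + N (1,0,1)"
    and "hamming_weight (x + y + z) = N (1,0,0) + N (0,1,0) + N (0,0,1) + N (1,1,1)"
    and "n = N (0,0,0) + N (1,0,0) + N (0,1,0) + N (0,0,1) + N (1,1,0) + N (1,0,1) + N (0,1,1) + N (1,1,1)"
proof -
  have w: "hamming_weight v = sum N P"
    if "v \<in> carrier_vec n" "finite P"
      "\<And>i. i < n \<Longrightarrow> v $ i \<noteq> 0 \<longleftrightarrow> (x $ i, y $ i, z $ i) \<in> P" for v P
    using card_columns[OF that(2,3)] that(1) unfolding hamming_weight_def N_def by auto
  have bits: "a \<noteq> 0 \<longleftrightarrow> (a, b, c) \<in> {(1,0,0), (1,1,0), (1,0,1), (1,1,1)}"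
    "b \<noteq> 0 \<longleftrightarrow> (a, b, c) \<in> {(0,1,0), (1,1,0), (0,1,1), (1,1,1)}"
    "c \<noteq> 0 \<longleftrightarrow> (a, b, c) \<in> {(0,0,1), (1,0,1), (0,1,1), (1,1,1)}"
    "a + b \<noteq> 0 \<longleftrightarrow> (a, b, c) \<in> {(1,0,0), (0,1,0), (1,0,1), (0,1,1)}"
    "a + c \<noteq> 0 \<longleftrightarrow> (a, b, c) \<in> {(1,0,0), (0,0,1), (1,1,0), (0,1,1)}"
    "b + c \<noteq> 0 \<longleftrightarrow> (a, b, c) \<in> {(0,1,0), (0,0,1), (1,1,0), (1,0,1)}"
    "a + b + c \<noteq> 0 \<longleftrightarrow> (a, b, c) \<in> {(1,0,0), (0,1,0), (0,0,1), (1,1,1)}" for a b c :: bit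
    by (cases a; cases b; cases c; simp)+
  note d = c[unfolded carrier_vec_def mem_Collect_eq]
  show "hamming_weight x = N (1,0,0) + N (1,1,0) + N (1,0,1) + N (1,1,1)"
    using bits(1) c d by (subst w[of _ "{(1,0,0), (1,1,0), (1,0,1), (1,1,1)}"]) auto
  show "hamming_weight y = N (0,1,0) + N (1,1,0) + N (0,1,1) + N (1,1,1)"
    using bits(2) c d by (subst w[of _ "{(0,1,0), (1,1,0), (0,1,1), (1,1,1)}"]) auto
  show "hamming_weight z = N (0,0,1) + N (1,0,1) + N (0,1,1) + N (1,1,1)"
    using bits(3) c d by (subst w[of _ "{(0,0,1), (1,0,1), (0,1,1), (1,1,1)}"]) auto
  show "hamming_weight (x + y) = N (1,0,0) + N (0,1,0) + N (1,0,1) + N (0,1,1)"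
    using bits(4) c d by (subst w[of _ "{(1,0,0), (0,1,0), (1,0,1), (0,1,1)}"]) auto
  show "hamming_weight (x + z) = N (1,0,0) + N (0,0,1) + N (1,1,0) + N (0,1,1)"
    using bits(5) c d by (subst w[of _ "{(1,0,0), (0,0,1), (1,1,0), (0,1,1)}"]) auto
  show "hamming_weight (y + z) = N (0,1,0) + N (0,0,1) + N (1,1,0) + N (1,0,1)"
    using bits(6) c d by (subst w[of _ "{(0,1,0), (0,0,1), (1,1,0), (1,0,1)}"]) auto
  show "hamming_weight (x + y + z) = N (1,0,0) + N (0,1,0) + N (0,0,1) + N (1,1,1)"
    using bits(7) c d by (subst w[of _ "{(1,0,0), (0,1,0), (0,0,1), (1,1,1)}"]) auto
  let ?U = "{(0,0,0), (1,0,0), (0,1,0), (0,0,1), (1,1,0), (1,0,1), (0,1,1), (1,1,1)} :: (bit \<times> bit \<times> bit) set"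
  have "(a, b, c) \<in> ?U" for a b c
    by (cases a; cases b; cases c; simp)
  then have "card {i. i < n \<and> True} = sum N ?U"
    unfolding N_def by (intro card_columns) auto
  then show "n = N (0,0,0) + N (1,0,0) + N (0,1,0) + N (0,0,1) + N (1,1,0) + N (1,0,1) + N (0,1,1) + N (1,1,1)"
    by simp
qed

text \<open>Equal multiplicities mean that both generator matrices have the same multiset of
  columns, so some permutation carries one list of columns to the other. Being additive, its action
  maps all words correctly once it does so for the basis.\<close>

lemma code_equiv_if_column_counts_eq:
  assumes C: "basis3 n C x y z" and D: "basis3 n D x' y' z'"
    and eq: "column_count n x y z = column_count n x' y' z'"
  shows "code_equiv n C D"
proof -
  define L where "L = map (\<lambda>i. (x $ i, y $ i, z $ i)) [0..<n]"
  define L' where "L' = map (\<lambda>i. (x' $ i, y' $ i, z' $ i)) [0..<n]"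
  have count: "count (mset (map f [0..<n])) p = card {i. i < n \<and> f i = p}"
    for f :: "nat \<Rightarrow> bit \<times> bit \<times> bit" and p
  proof -
    have "{i. i < n \<and> p = map f [0..<n] ! i} = {i. i < n \<and> f i = p}" by auto
    then show ?thesis
      unfolding count_mset count_list_eq_length_filter length_filter_conv_card by simp
  qed
  have "mset L' = mset L"
    unfolding L_def L'_def
    by (rule multiset_eqI) (simp only: count eq flip: column_count_def)
  then obtain \<pi> where "\<pi> permutes {..<length L}" "permute_list \<pi> L = L'"
    by (rule mset_eq_permutation)
  then have \<pi>: "\<pi> permutes {..<n}" "permute_list \<pi> L = L'"
    by (auto simp: L_def)
  have lt: "\<pi> i < n" if "i < n" for i
    using permutes_in_image[OF \<pi>(1), of i] that by simp
  \<comment> \<open>\<open>permute_list\<close> reads entry \<open>\<pi> i\<close> at position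
    \<open>i\<close>, the same direction as \<open>permute_coords\<close>.\<close>
  have col: "(x' $ i, y' $ i, z' $ i) = (x $ \<pi> i, y $ \<pi> i, z $ \<pi> i)" if "i < n" for i
  proof -
    have "L' ! i = L ! \<pi> i"
      using permute_list_nth[of \<pi> L i] \<pi> that by (simp add: L_def)
    then show ?thesis
      using that lt[OF that] by (simp add: L_def L'_def)
  qed
  have c: "x \<in> carrier_vec n" "y \<in> carrier_vec n" "z \<in> carrier_vec n"
    "x' \<in> carrier_vec n" "y' \<in> carrier_vec n" "z' \<in> carrier_vec n"
    using C D by (auto simp: basis3_def)
  have add: "permute_coords n \<pi> (u + v) = permute_coords n \<pi> u + permute_coords n \<pi> v"
    if "u \<in> carrier_vec n" "v \<in> carrier_vec n" for u v
    unfolding permute_coords_def using that lt by (intro eq_vecI) auto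
  have "permute_coords n \<pi> x = x'" "permute_coords n \<pi> y = y'" "permute_coords n \<pi> z = z'"
    unfolding permute_coords_def using c col by (auto intro!: eq_vecI)
  moreover have "permute_coords n \<pi> (0\<^sub>v n) = 0\<^sub>v n"
    unfolding permute_coords_def using lt by (intro eq_vecI) auto
  ultimately have "permute_coords n \<pi> ` C = D"
    using C D c unfolding basis3_def by (elim conjE) (simp add: add)
  then show ?thesis
    unfolding code_equiv_def using \<pi>(1) by auto
qed

text \<open>Inversion of the linear system of \<open>hamming_weight_columns\<close>, cleared of subtraction.\<close>

lemma column_count_weights:
  assumes c: "x \<in> carrier_vec n" "y \<in> carrier_vec n" "z \<in> carrier_vec n"
  defines "S \<equiv> hamming_weight x +
    hamming_weight y +
    hamming_weight z +
    hamming_weight (x + y) +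
    hamming_weight (x + z) +
    hamming_weight (y + z) +
    hamming_weight (x + y + z)"
  shows "4 * column_count n x y z (1,0,0) + S = 2 * (hamming_weight x + hamming_weight (x + y) + hamming_weight (x + z) + hamming_weight (x + y + z))"
    and "4 * column_count n x y z (0,1,0) + S = 2 * (hamming_weight y + hamming_weight (x + y) + hamming_weight (y + z) + hamming_weight (x + y + z))"
    and "4 * column_count n x y z (0,0,1) + S = 2 * (hamming_weight z + hamming_weight (x + z) + hamming_weight (y + z) + hamming_weight (x + y + z))"
    and "4 * column_count n x y z (1,1,0) + S = 2 * (hamming_weight x + hamming_weight y + hamming_weight (x + z) + hamming_weight (y + z))"
    and "4 * column_count n x y z (1,0,1) + S = 2 * (hamming_weight x + hamming_weight z + hamming_weight (x + y) + hamming_weight (y + z))"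
    and "4 * column_count n x y z (0,1,1) + S = 2 * (hamming_weight y + hamming_weight z + hamming_weight (x + y) + hamming_weight (x + z))"
    and "4 * column_count n x y z (1,1,1) + S = 2 * (hamming_weight x + hamming_weight y + hamming_weight z + hamming_weight (x + y + z))"
    and "4 * column_count n x y z (0,0,0) + S = 4 * n"
proof -
  \<comment> \<open>Each nonzero column is counted by four of the seven words, so \<open>S\<close>
    is four times the number of nonzero columns.\<close>
  have "n = column_count n x y z (0,0,0) + column_count n x y z (1,0,0) + column_count n x y z (0,1,0)
    + column_count n x y z (0,0,1) + column_count n x y z (1,1,0) + column_count n x y z (1,0,1)
    + column_count n x y z (0,1,1) + column_count n x y z (1,1,1)"
    by (rule hamming_weight_columns(8)[OF c])
  then show "4 * column_count n x y z (0,0,0) + S = 4 * n"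
    unfolding S_def hamming_weight_columns(1-7)[OF c] by linarith
qed (simp_all add: S_def hamming_weight_columns(1-7)[OF c])

text \<open>The linear system relating weights and column multiplicities is invertible, so the
  length and the seven weights fix all eight multiplicities.\<close>

lemma code_equiv_if_weights_eq:
  assumes C: "basis3 n C x y z" and D: "basis3 n D x' y' z'"
    and eq: "hamming_weight x = hamming_weight x'" "hamming_weight y = hamming_weight y'"
    "hamming_weight z = hamming_weight z'" "hamming_weight (x + y) = hamming_weight (x' + y')"
    "hamming_weight (x + z) = hamming_weight (x' + z')"
    "hamming_weight (y + z) = hamming_weight (y' + z')"
    "hamming_weight (x + y + z) = hamming_weight (x' + y' + z')"
  shows "code_equiv n C D"
proof (rule code_equiv_if_column_counts_eq[OF C D])
  have c: "x \<in> carrier_vec n" "y \<in> carrier_vec n" "z \<in> carrier_vec n"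
    "x' \<in> carrier_vec n" "y' \<in> carrier_vec n" "z' \<in> carrier_vec n"
    using C D by (auto simp: basis3_def)
  \<comment> \<open>Once \<open>eq\<close> is rewritten, both systems share the total
    \<open>S\<close> and the right-hand sides, so the counts can be compared equation by
    equation.\<close>
  have cancel: "k = l" if "4 * k + m = r" "4 * l + m = r" for k l m r :: nat
    using that by simp
  note e = column_count_weights[OF c(1-3), unfolded eq] and e' = column_count_weights[OF c(4-6)]
  have "column_count n x y z (a, b, c) = column_count n x' y' z' (a, b, c)" for a b c
    by (cases a; cases b; cases c) (simp_all only: cancel[OF e(1) e'(1)] cancel[OF e(2) e'(2)]
        cancel[OF e(3) e'(3)] cancel[OF e(4) e'(4)] cancel[OF e(5) e'(5)] cancel[OF e(6) e'(6)]
        cancel[OF e(7) e'(7)] cancel[OF e(8) e'(8)])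
  then show "column_count n x y z = column_count n x' y' z'"
    by auto
qed

section \<open>Weights, parity and inner products\<close>

text \<open>\<open>k\<close> is the size of the overlap of the two supports: the sum is supported on
  their symmetric difference, and the inner product counts the overlap modulo 2.\<close>

lemma hamming_weight_add:
  assumes "u \<in> carrier_vec n" "v \<in> carrier_vec n"
  obtains k where "hamming_weight u + hamming_weight v = hamming_weight (u + v) + 2 * k"
    and "u \<bullet> v = of_nat k"
proof -
  define U where "U = {i. i < n \<and> u $ i \<noteq> 0}"
  define V where "V = {i. i < n \<and> v $ i \<noteq> 0}"
  have fin: "finite U" "finite V" by (auto simp: U_def V_def)
  have b: "a + b \<noteq> 0 \<longleftrightarrow> (a \<noteq> 0 \<and> \<not> b \<noteq> 0) \<or> (b \<noteq> 0 \<and> \<not> a \<noteq> 0)"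
    "a * b = of_bool (a \<noteq> 0 \<and> b \<noteq> 0)" for a b :: bit
    by (cases a; cases b; simp)+
  have "hamming_weight (u + v) = card ((U - V) \<union> (V - U))"
    unfolding hamming_weight_def U_def V_def using assms b
    by (intro arg_cong[of _ _ card]) auto
  also have "\<dots> = card (U - V) + card (V - U)"
    using fin by (intro card_Un_disjoint) auto
  finally have "hamming_weight (u + v) = card (U - V) + card (V - U)" .
  moreover have "hamming_weight u = card (U - V) + card (U \<inter> V)"
    using assms fin card_Diff_subset_Int[of U V] card_mono[of U "U \<inter> V"]
    by (simp add: hamming_weight_def U_def)
  moreover have "hamming_weight v = card (V - U) + card (U \<inter> V)"
    using assms fin card_Diff_subset_Int[of V U] card_mono[of V "U \<inter> V"]
    by (simp add: hamming_weight_def V_def Int_commute)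
  moreover have "u \<bullet> v = of_nat (card (U \<inter> V))"
  proof -
    have "u \<bullet> v = (\<Sum>i = 0..<n. of_bool (i \<in> U \<inter> V))"
      unfolding scalar_prod_def using assms by (intro sum.cong) (auto simp: b(2) U_def V_def)
    also have "\<dots> = of_nat (card ({0..<n} \<inter> (U \<inter> V)))"
      by (subst sum_of_bool_eq) (simp_all add: Collect_mem_eq Int_def)
    also have "{0..<n} \<inter> (U \<inter> V) = U \<inter> V" by (auto simp: U_def)
    finally show ?thesis .
  qed
  ultimately show ?thesis by (intro that[of "card (U \<inter> V)"]) auto
qed

lemma of_nat_bit_eq_0_iff: "(of_nat k :: bit) = 0 \<longleftrightarrow> even k"
  by (induction k) auto

lemma hamming_weight_zero: "hamming_weight (0\<^sub>v n) = 0"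
  by (simp add: hamming_weight_def)

lemma scalar_prod_self_eq_0_iff:
  assumes "u \<in> carrier_vec n"
  shows "u \<bullet> u = 0 \<longleftrightarrow> even (hamming_weight u)"
proof -
  obtain k where "hamming_weight u + hamming_weight u = hamming_weight (u + u) + 2 * k"
    and "u \<bullet> u = of_nat k"
    using hamming_weight_add[OF assms assms] .
  then have "hamming_weight u = k" "u \<bullet> u = of_nat k"
    by (simp_all add: bit_vec_add_self[OF assms] hamming_weight_zero)
  then show ?thesis
    by (simp add: of_nat_bit_eq_0_iff)
qed

lemma even_hamming_weight_add:
  assumes "u \<in> carrier_vec n" "v \<in> carrier_vec n"
  shows "even (hamming_weight (u + v)) \<longleftrightarrow> (even (hamming_weight u) \<longleftrightarrow> even (hamming_weight v))"
proof -
  obtain k where "hamming_weight u + hamming_weight v = hamming_weight (u + v) + 2 * k"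
    using hamming_weight_add[OF assms] .
  then show ?thesis by presburger
qed

text \<open>If adding \<open>u\<close> keeps the weight of \<open>v\<close>, the overlap of the
  supports is half the weight of \<open>u\<close>, hence even.\<close>

lemma scalar_prod_eq_0_if_translate:
  assumes "u \<in> carrier_vec n" "v \<in> carrier_vec n"
    and "4 dvd hamming_weight u" "hamming_weight (u + v) = hamming_weight v"
  shows "u \<bullet> v = 0"
proof -
  obtain k where k: "hamming_weight u + hamming_weight v = hamming_weight (u + v) + 2 * k"
    "u \<bullet> v = of_nat k"
    using hamming_weight_add[OF assms(1,2)] .
  then have "4 dvd 2 * k" using assms by simp
  then show ?thesis using k by (auto simp: of_nat_bit_eq_0_iff)
qed

section \<open>The LCD condition tested on a basis\<close>

text \<open>By bilinearity, orthogonality to the code is orthogonality to the basis, and the zero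
  word always lies in the intersection with the dual.\<close>

lemma lcd_code_iff:
  assumes "basis3 n D x y z"
  shows "lcd_code n D \<longleftrightarrow> (\<forall>u\<in>D. u \<bullet> x = 0 \<and> u \<bullet> y = 0 \<and> u \<bullet> z = 0 \<longrightarrow> u = 0\<^sub>v n)"
proof -
  have c: "x \<in> carrier_vec n" "y \<in> carrier_vec n" "z \<in> carrier_vec n"
    and D: "D = {0\<^sub>v n, x, y, z, x + y, x + z, y + z, x + y + z}"
    using assms by (auto simp: basis3_def)
  have sub: "D \<subseteq> carrier_vec n" "0\<^sub>v n \<in> D" using c D by auto
  have "(\<forall>w\<in>D. u \<bullet> w = 0) \<longleftrightarrow> u \<bullet> x = 0 \<and> u \<bullet> y = 0 \<and> u \<bullet> z = 0" if "u \<in> D" for u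
  proof -
    have u: "u \<in> carrier_vec n" using that sub by auto
    have "u \<bullet> (x + y) = u \<bullet> x + u \<bullet> y" "u \<bullet> (x + z) = u \<bullet> x + u \<bullet> z" "u \<bullet> (y + z) = u \<bullet> y + u \<bullet> z"
      "u \<bullet> (x + y + z) = u \<bullet> x + u \<bullet> y + u \<bullet> z"
      using u c by (simp_all add: scalar_prod_add_distrib[of _ n])
    then show ?thesis
      unfolding D using u by auto
  qed
  moreover have "0\<^sub>v n \<bullet> w = 0" if "w \<in> D" for w
    using that sub by auto
  moreover have "lcd_code n D \<longleftrightarrow> (\<forall>u\<in>D. (\<forall>w\<in>D. u \<bullet> w = 0) \<longrightarrow> u = 0\<^sub>v n)"
    unfolding lcd_code_def dual_code_def using sub calculation(2) by blast
  ultimately show ?thesis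
    by simp
qed

text \<open>If all weights were even, the Gram matrix would be alternating of odd order, hence singular.\<close>

lemma lcd_code_odd_word:
  assumes b: "basis3 n D x y z" and lcd: "lcd_code n D"
  obtains u where "u \<in> D" "odd (hamming_weight u)"
proof (rule ccontr)
  assume "\<not> thesis"
  then have even: "even (hamming_weight u)" if "u \<in> D" for u
    using that \<open>\<And>u. u \<in> D \<Longrightarrow> odd (hamming_weight u) \<Longrightarrow> thesis\<close> by blast
  have c: "x \<in> carrier_vec n" "y \<in> carrier_vec n" "z \<in> carrier_vec n"
    and D: "{x, y, z, x + y, x + z, y + z, x + y + z} \<subseteq> D"
    and nz: "0\<^sub>v n \<notin> {x, y, z, x + y, x + z, y + z, x + y + z}"
    using b by (auto simp: basis3_def)
  have self: "x \<bullet> x = 0" "y \<bullet> y = 0" "z \<bullet> z = 0"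
    using D even c[THEN scalar_prod_self_eq_0_iff] by auto
  have comm: "y \<bullet> x = x \<bullet> y" "z \<bullet> x = x \<bullet> z" "z \<bullet> y = y \<bullet> z"
    by (rule comm_scalar_prod[OF c(2,1)] comm_scalar_prod[OF c(3,1)] comm_scalar_prod[OF c(3,2)])+
  have add: "(u + v) \<bullet> w = u \<bullet> w + v \<bullet> w"
    if "u \<in> carrier_vec n" "v \<in> carrier_vec n" "w \<in> carrier_vec n" for u v w :: "bit vec"
    using that by (rule add_scalar_prod_distrib)
  have "\<not> (u \<bullet> x = 0 \<and> u \<bullet> y = 0 \<and> u \<bullet> z = 0)" if "u \<in> {x, y, z, x + y, x + z, y + z, x + y + z}" for u
  proof -
    have "u \<in> D" "u \<noteq> 0\<^sub>v n"
      using subsetD[OF D that] nz that by metis+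
    then show ?thesis
      using lcd unfolding lcd_code_iff[OF b] by blast
  qed
  \<comment> \<open>Only three Gram entries are left. The word with coefficients
    \<open>y \<bullet> z\<close>, \<open>x \<bullet> z\<close>, \<open>x \<bullet> y\<close> at
    \<open>x\<close>, \<open>y\<close>, \<open>z\<close> is orthogonal to the basis; if all three
    vanish, every word is.\<close>
  from this[of x] this[of y] this[of z] this[of "x + y"] this[of "x + z"] this[of "y + z"]
    this[of "x + y + z"]
  show False
    by (cases "x \<bullet> y"; cases "x \<bullet> z"; cases "y \<bullet> z") (simp_all add: add c self comm)
qed

text \<open>The hypotheses put the nonzero word \<open>u\<close> into the dual code.\<close>

lemma lcd_code_no_radical:
  assumes b: "basis3 n D x y z" and lcd: "lcd_code n D"
    and u: "u \<in> D" "u \<noteq> 0\<^sub>v n" "4 dvd hamming_weight u"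
    and inv: "\<And>v. v \<in> {x, y, z} \<Longrightarrow> u \<noteq> v \<Longrightarrow> hamming_weight (u + v) = hamming_weight v"
  shows False
proof -
  have c: "{x, y, z} \<subseteq> carrier_vec n" "D \<subseteq> carrier_vec n"
    using b by (auto simp: basis3_def)
  have "u \<bullet> v = 0" if "v \<in> {x, y, z}" for v
  proof (cases "u = v")
    \<comment> \<open>This case is outside \<open>inv\<close>; here orthogonality comes from the
      even weight of \<open>u\<close>.\<close>
    case True
    then show ?thesis
      using u(3) c that scalar_prod_self_eq_0_iff[of u n] dvd_trans[of 2 4 "hamming_weight u"] by auto
  next
    case False
    then show ?thesis
      using u c that inv by (intro scalar_prod_eq_0_if_translate[of u n]) auto
  qed
  then show False
    using lcd u unfolding lcd_code_iff[OF b] by blast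
qed

section \<open>The weights forced by the minimum distance\<close>

text \<open>A heaviest odd word \<open>d\<close> is completed to a basis, and adding
  \<open>d\<close> corrects the parity of the other two words. Its maximality later settles which
  odd word may exceed its bound.\<close>

lemma lcd_code_parity_basis:
  assumes b: "basis3 n D x y z" and lcd: "lcd_code n D"
  obtains d e f where "basis3 n D d e f" "odd (hamming_weight d)" "even (hamming_weight e)"
    "even (hamming_weight f)" "\<forall>u\<in>D. odd (hamming_weight u) \<longrightarrow> hamming_weight u \<le> hamming_weight d"
proof -
  let ?O = "{u \<in> D. odd (hamming_weight u)}"
  obtain u where "u \<in> ?O"
    using lcd_code_odd_word[OF b lcd] by auto
  moreover have "finite ?O"
    using b by (auto simp: basis3_def)
  ultimately have "Max (hamming_weight ` ?O) \<in> hamming_weight ` ?O"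
    by (intro Max_in) auto
  then obtain d where d: "d \<in> ?O" "hamming_weight d = Max (hamming_weight ` ?O)"
    by auto
  have max: "hamming_weight u \<le> hamming_weight d" if "u \<in> D" "odd (hamming_weight u)" for u
    using that \<open>finite ?O\<close> d(2) by auto
  have "d \<noteq> 0\<^sub>v n" using d(1) by (auto simp: hamming_weight_zero)
  then obtain v w where vw: "basis3 n D d v w"
    using basis3_extend[OF b _ \<open>d \<noteq> 0\<^sub>v n\<close>] d(1) by blast
  then have c: "d \<in> carrier_vec n" "v \<in> carrier_vec n" "w \<in> carrier_vec n"
    by (auto simp: basis3_def)
  have shift: "basis3 n D d (v + d) w" if "basis3 n D d v w" for v w
    using that basis3_swap12 basis3_add12 by blast
  \<comment> \<open>\<open>e\<close> is \<open>v\<close> or \<open>v + d\<close>, whichever has even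
    weight.\<close>
  obtain e where e: "basis3 n D d e w" "even (hamming_weight e)"
    using vw shift[OF vw] even_hamming_weight_add[OF c(2,1)] d by auto
  obtain f where "basis3 n D d f e" "even (hamming_weight f)"
    using basis3_swap23[OF e(1)] shift[OF basis3_swap23[OF e(1)]]
      even_hamming_weight_add[OF c(3,1)] d by auto
  then show ?thesis
    using that[of d f e] e d max by auto
qed

text \<open>The bound \<open>4 * s + 1 + t\<close> is odd for \<open>t = 0\<close> and even for
  \<open>t = 1\<close>; rounding it up to the parity of \<open>w\<close> gives the two
  formulas.\<close>

lemma parity_bound:
  fixes w s t :: nat
  assumes "4 * s + 1 + t \<le> w" "t \<le> 1"
  shows "even w \<Longrightarrow> \<exists>k. w = 4 * s + 2 + 2 * k"
    and "odd w \<Longrightarrow> \<exists>k. w = 4 * s + 1 + 2 * t + 2 * k"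
proof -
  show "\<exists>k. w = 4 * s + 2 + 2 * k" if "even w"
  proof -
    obtain j where "w = 2 * j" using \<open>even w\<close> by (elim evenE)
    then show ?thesis using assms by (intro exI[of _ "j - (2 * s + 1)"]) auto
  qed
  show "\<exists>k. w = 4 * s + 1 + 2 * t + 2 * k" if "odd w"
  proof -
    obtain j where "w = 2 * j + 1" using \<open>odd w\<close> by (elim oddE)
    then show ?thesis using assms by (intro exI[of _ "j - (2 * s + t)"]) auto
  qed
qed

lemma lcd_code_weights:
  assumes b: "basis3 n D x y z" and lcd: "lcd_code n D"
    and n: "n = 7 * s + 3 + 2 * t" and t: "t \<le> 1"
    and min: "\<And>u. u \<in> D \<Longrightarrow> u \<noteq> 0\<^sub>v n \<Longrightarrow> 4 * s + 1 + t \<le> hamming_weight u"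
  obtains d e f where "basis3 n D d e f"
    "hamming_weight e = 4 * s + 2" "hamming_weight f = 4 * s + 2" "hamming_weight (e + f) = 4 * s + 2"
    "hamming_weight (d + e) = 4 * s + 1 + 2 * t" "hamming_weight (d + f) = 4 * s + 1 + 2 * t"
    "hamming_weight (d + e + f) = 4 * s + 1 + 2 * t" "hamming_weight d = 4 * s + 3 + 2 * t"
proof -
  obtain d e f where def: "basis3 n D d e f" and par: "odd (hamming_weight d)"
      "even (hamming_weight e)" "even (hamming_weight f)"
    and max: "\<forall>u\<in>D. odd (hamming_weight u) \<longrightarrow> hamming_weight u \<le> hamming_weight d"
    using lcd_code_parity_basis[OF b lcd] .
  have c: "d \<in> carrier_vec n" "e \<in> carrier_vec n" "f \<in> carrier_vec n"
    and D: "d \<in> D" "e \<in> D" "f \<in> D" "d + e \<in> D" "d + f \<in> D" "e + f \<in> D" "d + e + f \<in> D"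
    and nz: "d \<noteq> 0\<^sub>v n" "e \<noteq> 0\<^sub>v n" "f \<noteq> 0\<^sub>v n" "d + e \<noteq> 0\<^sub>v n" "d + f \<noteq> 0\<^sub>v n" "e + f \<noteq> 0\<^sub>v n"
      "d + e + f \<noteq> 0\<^sub>v n"
    using def by (auto simp: basis3_def)
  have par': "even (hamming_weight (e + f))" "odd (hamming_weight (d + e))"
    "odd (hamming_weight (d + f))" "odd (hamming_weight (d + e + f))"
    using par even_hamming_weight_add[OF c(2,3)] even_hamming_weight_add[OF c(1,2)]
      even_hamming_weight_add[OF c(1,3)] even_hamming_weight_add[OF add_carrier_vec[OF c(1,2)] c(3)]
    by simp_all
  note bound = parity_bound[OF min t]
  obtain ke where ke: "hamming_weight e = 4 * s + 2 + 2 * ke"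
    using bound(1)[OF D(2) nz(2) par(2)] by blast
  obtain kf where kf: "hamming_weight f = 4 * s + 2 + 2 * kf"
    using bound(1)[OF D(3) nz(3) par(3)] by blast
  obtain kef where kef: "hamming_weight (e + f) = 4 * s + 2 + 2 * kef"
    using bound(1)[OF D(6) nz(6) par'(1)] by blast
  obtain kd where kd: "hamming_weight d = 4 * s + 1 + 2 * t + 2 * kd"
    using bound(2)[OF D(1) nz(1) par(1)] by blast
  obtain kde where kde: "hamming_weight (d + e) = 4 * s + 1 + 2 * t + 2 * kde"
    using bound(2)[OF D(4) nz(4) par'(2)] by blast
  obtain kdf where kdf: "hamming_weight (d + f) = 4 * s + 1 + 2 * t + 2 * kdf"
    using bound(2)[OF D(5) nz(5) par'(3)] by blast
  obtain kdef where kdef: "hamming_weight (d + e + f) = 4 * s + 1 + 2 * t + 2 * kdef"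
    using bound(2)[OF D(7) nz(7) par'(4)] by blast
  note k = ke kf kef kd kde kdf kdef
  \<comment> \<open>An excess on any odd word forces an excess on \<open>d\<close>.\<close>
  have le: "kde \<le> kd" "kdf \<le> kd" "kdef \<le> kd"
    using bspec[OF max D(4)] bspec[OF max D(5)] bspec[OF max D(7)] par'(2-4) unfolding k by simp_all
  define m where "m = column_count n d e f (0,0,0)"
  \<comment> \<open>The parity bounds add up to \<open>28 * s + 10 + 8 * t\<close>, whereas the
    weights plus four times the number \<open>m\<close> of zero columns give
    \<open>4 * n = 28 * s + 12 + 8 * t\<close>. Halving the difference leaves 1.\<close>
  have sum: "ke + kf + kef + kd + kde + kdf + kdef + 2 * m = 1"
    using column_count_weights(8)[OF c] n unfolding k m_def[symmetric] by linarith
  have "kd = 0 \<and> ke + kf + kef = 1 \<or>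
      kd = 1 \<and> ke = 0 \<and> kf = 0 \<and> kef = 0 \<and> kde = 0 \<and> kdf = 0 \<and> kdef = 0"
  proof (cases "kd = 0")
    case True
    then have "ke + kf + kef + 2 * m = 1" using sum le by simp
    moreover from this have "m = 0" by linarith
    ultimately show ?thesis using True by simp
  next
    case False
    then have "kd \<ge> 1" by simp
    then have "ke + kf + kef + kde + kdf + kdef = 0" "kd = 1" using sum by linarith+
    then show ?thesis by simp
  qed
  then consider (e) "ke = 1" "kf = 0" "kef = 0" "kd = 0" | (f) "ke = 0" "kf = 1" "kef = 0" "kd = 0"
    | (ef) "ke = 0" "kf = 0" "kef = 1" "kd = 0" | (d) "ke = 0" "kf = 0" "kef = 0" "kd = 1" "kde = 0" "kdf = 0" "kdef = 0"
    by (auto simp: add_is_1)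
  then show ?thesis
  proof cases
    \<comment> \<open>In this and the next two cases the exceptional even word has weight
      \<open>4 * s + 4\<close>, and adding it to any other basis word preserves the weight, so it
      would lie in the dual code.\<close>
    case e
    have False
    proof (rule lcd_code_no_radical[OF def lcd D(2) nz(2)])
      show "4 dvd hamming_weight e" unfolding k e by presburger
      show "hamming_weight (e + v) = hamming_weight v" if "v \<in> {d, e, f}" "e \<noteq> v" for v
        using that e le
        by (elim insertE emptyE) (simp_all only: comm_add_vec[OF c(2,1)] k, simp_all)
    qed
    then show ?thesis ..
  next
    case f
    have False
    proof (rule lcd_code_no_radical[OF def lcd D(3) nz(3)])
      show "4 dvd hamming_weight f" unfolding k f by presburger
      show "hamming_weight (f + v) = hamming_weight v" if "v \<in> {d, e, f}" "f \<noteq> v" for v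
        using that f le
        by (elim insertE emptyE) (simp_all only: comm_add_vec[OF c(3,1)] comm_add_vec[OF c(3,2)] k, simp_all)
    qed
    then show ?thesis ..
  next
    case ef
    have sums: "e + f + d = d + e + f" "e + f + e = f" "e + f + f = e"
      using comm_add_vec[of "e + f" n d] assoc_add_vec[OF c] comm_add_vec[OF c(2,3)]
        bit_vec_add_cancel[OF c(2,3)] bit_vec_add_cancel[OF c(3,2)] c by simp_all
    have False
    proof (rule lcd_code_no_radical[OF def lcd D(6) nz(6)])
      show "4 dvd hamming_weight (e + f)" unfolding k ef by presburger
      show "hamming_weight (e + f + v) = hamming_weight v" if "v \<in> {d, e, f}" for v
        using that ef le by (elim insertE emptyE) (simp_all add: sums k)
    qed
    then show ?thesis ..
  next
    case d
    then show ?thesis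
      using that[OF def] k by simp
  qed
qed

text \<open>The three lighter odd words form a basis: their pairwise sums are the three nonzero even
  words and their total is the heavy word \<open>d\<close>. This gives the weight table of the
  constructed code.\<close>

lemma lcd_code_normal_basis:
  assumes b: "basis3 n D x y z" and lcd: "lcd_code n D"
    and n: "n = 7 * s + 3 + 2 * t" and t: "t \<le> 1"
    and min: "\<And>u. u \<in> D \<Longrightarrow> u \<noteq> 0\<^sub>v n \<Longrightarrow> 4 * s + 1 + t \<le> hamming_weight u"
  obtains x' y' z' where "basis3 n D x' y' z'"
    "hamming_weight x' = 4 * s + 1 + 2 * t" "hamming_weight y' = 4 * s + 1 + 2 * t"
    "hamming_weight z' = 4 * s + 1 + 2 * t" "hamming_weight (x' + y') = 4 * s + 2"
    "hamming_weight (x' + z') = 4 * s + 2" "hamming_weight (y' + z') = 4 * s + 2"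
    "hamming_weight (x' + y' + z') = 4 * s + 3 + 2 * t"
proof -
  obtain d e f where def: "basis3 n D d e f" and w:
    "hamming_weight e = 4 * s + 2" "hamming_weight f = 4 * s + 2" "hamming_weight (e + f) = 4 * s + 2"
    "hamming_weight (d + e) = 4 * s + 1 + 2 * t" "hamming_weight (d + f) = 4 * s + 1 + 2 * t"
    "hamming_weight (d + e + f) = 4 * s + 1 + 2 * t" "hamming_weight d = 4 * s + 3 + 2 * t"
    using lcd_code_weights[OF b lcd n t min] .
  have c: "d \<in> carrier_vec n" "e \<in> carrier_vec n" "f \<in> carrier_vec n"
    using def by (auto simp: basis3_def)
  have index: "u = v" if "u \<in> carrier_vec n" "v \<in> carrier_vec n" "\<And>i. i < n \<Longrightarrow> u $ i = v $ i"
    for u v :: "bit vec" using that by (intro eq_vecI) auto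
  have bits: "a + b + (a + c) = b + c" "a + b + (a + b + c) = c" "a + c + (a + b + c) = b"
    "b + c + (a + b + c) = a" for a b c :: bit
    by (cases a; cases b; cases c; simp)+
  have sums: "d + e + (d + f) = e + f" "d + e + (d + e + f) = f" "d + f + (d + e + f) = e"
    "e + f + (d + e + f) = d"
    using c by (intro index; simp add: bits)+
  have "basis3 n D (d + e) (d + f) (d + e + f)"
    using def unfolding basis3_def sums by (elim conjE) (simp add: insert_commute)
  then show ?thesis
    using that[of "d + e" "d + f" "d + e + f"] w unfolding sums by simp
qed

section \<open>Construction of a code with the required weights\<close>

lemma vectors_with_columns:
  fixes L :: "(bit \<times> bit \<times> bit) list"
  obtains x y z where "x \<in> carrier_vec (length L)" "y \<in> carrier_vec (length L)"
    "z \<in> carrier_vec (length L)" "column_count (length L) x y z = count_list L"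
proof -
  let ?n = "length L"
  let ?x = "vec ?n (\<lambda>i. fst (L ! i))" and ?y = "vec ?n (\<lambda>i. fst (snd (L ! i)))"
    and ?z = "vec ?n (\<lambda>i. snd (snd (L ! i)))"
  have "column_count ?n ?x ?y ?z p = count_list L p" for p
    unfolding column_count_def count_list_eq_length_filter length_filter_conv_card
    by (rule arg_cong[of _ _ card]) auto
  then show ?thesis
    by (intro that[of ?x ?y ?z]) auto
qed

lemma count_list_replicate: "count_list (replicate k a) b = (if a = b then k else 0)"
  by (induction k) auto

lemma basis3_min_weight:
  assumes "basis3 n D x y z"
  shows "min_weight n D = Min {hamming_weight x, hamming_weight y, hamming_weight z,
    hamming_weight (x + y), hamming_weight (x + z), hamming_weight (y + z), hamming_weight (x + y + z)}"
proof -
  have "D - {0\<^sub>v n} = {x, y, z, x + y, x + z, y + z, x + y + z}"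
    using assms unfolding basis3_def by (metis Diff_insert_absorb)
  then show ?thesis by (simp add: min_weight_def)
qed

lemma normal_code_exists:
  assumes n: "n = 7 * s + 3 + 2 * t" and t: "t \<le> 1"
  obtains C x y z where "basis3 n C x y z" "lcd_code n C" "min_weight n C = 4 * s + 1 + t"
    "hamming_weight x = 4 * s + 1 + 2 * t" "hamming_weight y = 4 * s + 1 + 2 * t"
    "hamming_weight z = 4 * s + 1 + 2 * t" "hamming_weight (x + y) = 4 * s + 2"
    "hamming_weight (x + z) = 4 * s + 2" "hamming_weight (y + z) = 4 * s + 2"
    "hamming_weight (x + y + z) = 4 * s + 3 + 2 * t"
proof -
  \<comment> \<open>\<open>s\<close> copies of the simplex code, an identity matrix, and \<open>2 t\<close> all-one columns\<close>
  define L :: "(bit \<times> bit \<times> bit) list" where "L = replicate (s + 1) (1,0,0) @ replicate (s + 1) (0,1,0)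
    @ replicate (s + 1) (0,0,1) @ replicate s (1,1,0) @ replicate s (1,0,1) @ replicate s (0,1,1)
    @ replicate (s + 2 * t) (1,1,1)"
  have len: "length L = n" by (simp add: L_def n)
  obtain x y z where c: "x \<in> carrier_vec n" "y \<in> carrier_vec n" "z \<in> carrier_vec n"
    and N: "column_count n x y z = count_list L"
    using vectors_with_columns[of L] unfolding len .
  have w: "hamming_weight x = 4 * s + 1 + 2 * t" "hamming_weight y = 4 * s + 1 + 2 * t"
    "hamming_weight z = 4 * s + 1 + 2 * t" "hamming_weight (x + y) = 4 * s + 2"
    "hamming_weight (x + z) = 4 * s + 2" "hamming_weight (y + z) = 4 * s + 2"
    "hamming_weight (x + y + z) = 4 * s + 3 + 2 * t"
    unfolding hamming_weight_columns(1-7)[OF c] N L_def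
    by (simp_all add: count_list_replicate)
  define C where "C = {0\<^sub>v n, x, y, z, x + y, x + z, y + z, x + y + z}"
  have b: "basis3 n C x y z"
    unfolding basis3_def C_def using c w hamming_weight_zero[of n] by auto
  have self: "x \<bullet> x = 1" "y \<bullet> y = 1" "z \<bullet> z = 1"
    using scalar_prod_self_eq_0_iff[OF c(1)] scalar_prod_self_eq_0_iff[OF c(2)]
      scalar_prod_self_eq_0_iff[OF c(3)] w by auto
  have ortho: "u \<bullet> v = 0" if uv: "u \<in> carrier_vec n" "v \<in> carrier_vec n"
    "hamming_weight u = 4 * s + 1 + 2 * t" "hamming_weight v = 4 * s + 1 + 2 * t"
    "hamming_weight (u + v) = 4 * s + 2" for u v
  proof -
    obtain k where "hamming_weight u + hamming_weight v = hamming_weight (u + v) + 2 * k"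
      "u \<bullet> v = of_nat k"
      using hamming_weight_add[OF uv(1,2)] .
    \<comment> \<open>The overlap is half of
      \<open>2 * (4 * s + 1 + 2 * t) - (4 * s + 2)\<close>.\<close>
    then have "k = 2 * (s + t)" "u \<bullet> v = of_nat k" using uv by auto
    then show ?thesis by (simp add: of_nat_bit_eq_0_iff)
  qed
  have o: "x \<bullet> y = 0" "x \<bullet> z = 0" "y \<bullet> z = 0" "y \<bullet> x = 0" "z \<bullet> x = 0" "z \<bullet> y = 0"
    using ortho[OF c(1,2) w(1,2,4)] ortho[OF c(1,3) w(1,3,5)] ortho[OF c(2,3) w(2,3,6)]
      comm_scalar_prod[OF c(2,1)] comm_scalar_prod[OF c(3,1)] comm_scalar_prod[OF c(3,2)] by simp_all
  have add: "(u + v) \<bullet> w = u \<bullet> w + v \<bullet> w"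
    if "u \<in> carrier_vec n" "v \<in> carrier_vec n" "w \<in> carrier_vec n" for u v w :: "bit vec"
    using that by (rule add_scalar_prod_distrib)
  \<comment> \<open>The Gram matrix of the basis is the identity, so the products of a word with
    \<open>x\<close>, \<open>y\<close>, \<open>z\<close> are its coefficients.\<close>
  have "lcd_code n C"
    unfolding lcd_code_iff[OF b] unfolding C_def using c by (simp add: add self o)
  \<comment> \<open>The minimum is attained by the basis words when \<open>t = 0\<close> and by
    their pairwise sums when \<open>t = 1\<close>.\<close>
  moreover have "min_weight n C = 4 * s + 1 + t"
    unfolding basis3_min_weight[OF b] w using t by (cases t) auto
  ultimately show ?thesis
    using that[OF b] w by blast
qed

theorem theorem5p9:
  fixes n :: nat
  assumes "n \<ge> 5" and "n mod 7 = 3 \<or> n mod 7 = 5"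
  shows "\<exists>C. is_code n 3 (4 * n div 7) C \<and> lcd_code n C \<and>
           (\<forall>D. is_code n 3 (4 * n div 7) D \<and> lcd_code n D \<longrightarrow> code_equiv n C D)"
proof -
  \<comment> \<open>The parameter \<open>t\<close> treats the residues 3 and 5 together.\<close>
  define s t where "s = n div 7" and "t = (if n mod 7 = 3 then 0 else 1 :: nat)"
  have t: "t \<le> 1" by (simp add: t_def)
  have n: "n = 7 * s + 3 + 2 * t"
    using assms(2)
  proof
    assume "n mod 7 = 3"
    then show ?thesis unfolding s_def t_def by simp presburger
  next
    assume "n mod 7 = 5"
    then show ?thesis unfolding s_def t_def by simp presburger
  qed
  \<comment> \<open>Here \<open>4 * n = 7 * (4 * s) + 12 + 8 * t\<close>, and 12 and 20 have
    quotients 1 and 2 by 7.\<close>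
  have d: "4 * n div 7 = 4 * s + 1 + t"
    using t unfolding n by (cases t) auto
  obtain C x y z where C: "basis3 n C x y z" "lcd_code n C" "min_weight n C = 4 * s + 1 + t"
    and w: "hamming_weight x = 4 * s + 1 + 2 * t" "hamming_weight y = 4 * s + 1 + 2 * t"
    "hamming_weight z = 4 * s + 1 + 2 * t" "hamming_weight (x + y) = 4 * s + 2"
    "hamming_weight (x + z) = 4 * s + 2" "hamming_weight (y + z) = 4 * s + 2"
    "hamming_weight (x + y + z) = 4 * s + 3 + 2 * t"
    using normal_code_exists[OF n t] .
  have "is_code n 3 (4 * n div 7) C"
    unfolding is_code_def d using C basis3_imp_linear_code basis3_imp_code_dim by blast
  moreover have "code_equiv n C D" if "is_code n 3 (4 * n div 7) D" and lcd: "lcd_code n D" for D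
  proof -
    have D: "linear_code n D" "code_dim n D = 3" "min_weight n D = 4 * s + 1 + t"
      using that by (simp_all add: is_code_def d)
    obtain x0 y0 z0 where b: "basis3 n D x0 y0 z0"
      using basis3_exists[OF D(1,2)] .
    have "finite D" using b by (auto simp: basis3_def)
    then have min: "4 * s + 1 + t \<le> hamming_weight u" if "u \<in> D" "u \<noteq> 0\<^sub>v n" for u
      using that unfolding D(3)[symmetric] min_weight_def by (intro Min_le) auto
    obtain x' y' z' where "basis3 n D x' y' z'"
      "hamming_weight x' = 4 * s + 1 + 2 * t" "hamming_weight y' = 4 * s + 1 + 2 * t"
      "hamming_weight z' = 4 * s + 1 + 2 * t" "hamming_weight (x' + y') = 4 * s + 2"
      "hamming_weight (x' + z') = 4 * s + 2" "hamming_weight (y' + z') = 4 * s + 2"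
      "hamming_weight (x' + y' + z') = 4 * s + 3 + 2 * t"
      using lcd_code_normal_basis[OF b lcd n t min] .
    \<comment> \<open>Both codes now have bases with the same weight table, which determines the
      code up to equivalence.\<close>
    then show ?thesis
      using w by (intro code_equiv_if_weights_eq[OF C(1)]) auto
  qed
  ultimately show ?thesis
    using C(2) by blast
qed

end
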